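(* Let $n$ be a positive integer and $q$ a non-negative integer. The number of $(n+1)$-tuples of non-negative integers that sum up to at most $n(q-1)$ and for which the first $n$ entries are strictly smaller than $q$ equals $$\sum_{i=1}^{n} (-1)^{n-i}\binom{n}{i}\binom{iq+1}{n+1} = \frac{nq^{n+1}-(n-2)q^n}{2}.$$
   Context: Binomial coefficients $\binom{a}{b}$ with $0\le a<b$ are $0$. *)

theory Defs
  imports Complex_Main
begin

end

theory Submission
  imports Defs "HOL-Computational_Algebra.Formal_Power_Series"
begin

text \<open>
  Both quantities are computed independently. By the binomial theorem the alternating sum is the
  coefficient of \<open>X ^ (n + 1)\<close> in \<open>(1 + X) * ((1 + X) ^ q - 1) ^ n\<close>; since \<open>(1 + X) ^ q - 1\<close> is
  \<open>X\<close> times a series starting with \<open>q + (q choose 2) * X\<close>, only the first two coefficients of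
  the \<open>n\<close>-th power of that series matter. For the tuples, put \<open>m = q - 1\<close>: a choice of the first
  \<open>n\<close> entries with sum \<open>s\<close> leaves \<open>n * m - s + 1\<close> possibilities for the last one, and
  reflecting each entry by \<open>x \<mapsto> m - x\<close> shows that \<open>s\<close> is \<open>n * m / 2\<close> on average.
\<close>

unbundle fps_syntax

lemma fps_nth_one_plus_X_power:
  "((1 + fps_X) ^ m :: 'a::field_char_0 fps) $ k = of_nat (m choose k)"
  by (simp flip: fps_binomial_of_nat binomial_gbinomial)

lemma alternating_sum_choose_mult:
  fixes n q :: nat
  shows "(\<Sum>i=0..n. (-1) ^ (n - i) * real (n choose i) * real ((i * q + 1) choose (n + 1)))
           = (real n * real q ^ (n + 1) - (real n - 2) * real q ^ n) / 2"
proof -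
  define F :: "real fps" where "F = (1 + fps_X) ^ q"
  \<comment> \<open>As \<open>F\<close> has constant term 1, \<open>F - 1\<close> is divisible by
    \<open>fps_X\<close>; \<open>G\<close> is the quotient, with coefficients
    \<open>q choose (k + 1)\<close>.\<close>
  define G where "G = fps_shift 1 F"
  have F_nth: "F $ k = real (q choose k)" for k
    by (simp add: F_def fps_nth_one_plus_X_power)
  have F_eq: "F - 1 = fps_X * G"
    by (rule fps_ext) (simp add: G_def F_nth)
  have "(1 + fps_X) * (F - 1) ^ n
        = (\<Sum>i=0..n. fps_const ((-1) ^ (n - i) * real (n choose i)) * (1 + fps_X) ^ (i * q + 1))"
  proof -
    have "(F - 1) ^ n = (\<Sum>i=0..n. of_nat (n choose i) * F ^ i * (-1) ^ (n - i))"
      using binomial_ring[of F "-1" n] by (simp add: atLeast0AtMost)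
    \<comment> \<open>The summand \<open>+ 1\<close> in \<open>i * q + 1\<close> is what the extra
      factor \<open>1 + fps_X\<close> produces.\<close>
    moreover have "fps_const ((-1) ^ (n - i) * real (n choose i)) * (1 + fps_X) ^ (i * q + 1)
        = (1 + fps_X) * (of_nat (n choose i) * F ^ i * (-1) ^ (n - i))" for i
    proof -
      have "fps_const ((-1) ^ (n - i) * real (n choose i)) = (-1) ^ (n - i) * of_nat (n choose i)"
        by (simp add: fps_of_nat flip: fps_const_mult fps_const_power fps_const_neg)
      moreover have "(1 + fps_X :: real fps) ^ (i * q + 1) = (1 + fps_X) * F ^ i"
        by (simp add: F_def mult.commute flip: power_mult)
      ultimately show ?thesis by (simp only: mult_ac)
    qed
    ultimately show ?thesis
      by (simp only: sum_distrib_left)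
  qed
  then have "((1 + fps_X) * (F - 1) ^ n) $ (n + 1)
      = (\<Sum>i=0..n. (-1) ^ (n - i) * real (n choose i) * real ((i * q + 1) choose (n + 1)))"
    by (simp only: fps_sum_nth fps_mult_left_const_nth fps_nth_one_plus_X_power)
  \<comment> \<open>Pulling out \<open>fps_X ^ n\<close> leaves the coefficient of
    \<open>fps_X\<close> in \<open>(1 + fps_X) * G ^ n\<close>.\<close>
  moreover have "((1 + fps_X) * (F - 1) ^ n) $ (n + 1) = (G ^ n) $ 0 + (G ^ n) $ 1"
  proof -
    have "(1 + fps_X) * (F - 1) ^ n = fps_X ^ n * ((1 + fps_X) * G ^ n)"
      by (simp add: F_eq power_mult_distrib mult_ac)
    then show ?thesis
      by (simp add: fps_X_power_mult_nth algebra_simps)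
  qed
  moreover have "(G ^ n) $ 0 = real q ^ n"
    by (simp add: G_def F_nth fps_nth_power_0)
  \<comment> \<open>The linear coefficient of a power is
    \<open>n * (G $ 0) ^ (n - 1) * G $ 1\<close>, with \<open>G $ 0 = q\<close> and
    \<open>G $ 1 = q choose 2\<close>.\<close>
  moreover have "(G ^ n) $ 1 = real n * real q ^ n * (real q - 1) / 2"
  proof -
    have "real (q choose 2) = real q * (real q - 1) / 2"
      by (cases q) (simp_all add: choose_two real_of_nat_div field_simps)
    then show ?thesis
      unfolding fps_power_first
      by (cases n) (simp_all add: G_def F_nth numeral_2_eq_2)
  qed
  ultimately show ?thesis
    by (simp add: field_simps)
qed

lemma card_box_lists:
  "card {ys::nat list. length ys = n \<and> set ys \<subseteq> {..<q}} = q ^ n"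
  using card_lists_length_eq[of "{..<q}" n] by (simp add: conj_commute)

lemma sum_list_map_reflect:
  fixes ys :: "nat list"
  assumes "set ys \<subseteq> {..m}"
  shows "int (sum_list (map (\<lambda>x. m - x) ys)) = int (length ys) * int m - int (sum_list ys)"
  using assms by (induction ys) (auto simp: algebra_simps of_nat_diff)

text \<open>Reflecting entries is an involution of the box that turns a sum s into
  \<open>n * m\<close> - s, so the total equals \<open>n * m\<close> times the size of the box,
  minus itself. Doubling avoids a division.\<close>

lemma sum_sum_list_box:
  "2 * (\<Sum>ys | length ys = n \<and> set ys \<subseteq> {..<Suc m}. int (sum_list ys))
     = int n * int m * int (Suc m) ^ n"
proof -
  let ?L = "{ys. length ys = n \<and> set ys \<subseteq> {..<Suc m}}"
  have "(\<Sum>ys\<in>?L. int (sum_list ys)) = (\<Sum>ys\<in>?L. int n * int m - int (sum_list ys))"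
  proof (rule sum.reindex_bij_witness[where i = "map (\<lambda>x. m - x)" and j = "map (\<lambda>x. m - x)"])
    fix ys assume ys: "ys \<in> ?L"
    then have le: "set ys \<subseteq> {..m}" by auto
    show "map (\<lambda>x. m - x) (map (\<lambda>x. m - x) ys) = ys"
      using le by (auto simp: o_def intro!: map_idI)
    then show "map (\<lambda>x. m - x) (map (\<lambda>x. m - x) ys) = ys" .
    show "map (\<lambda>x. m - x) ys \<in> ?L" using ys by auto
    then show "map (\<lambda>x. m - x) ys \<in> ?L" .
    show "int n * int m - int (sum_list (map (\<lambda>x. m - x) ys)) = int (sum_list ys)"
      using sum_list_map_reflect[OF le] ys by simp
  qed
  also have "\<dots> = int n * int m * int (Suc m) ^ n - (\<Sum>ys\<in>?L. int (sum_list ys))"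
    by (simp only: sum_subtractf sum_constant card_box_lists of_nat_power mult_ac)
  finally show ?thesis by simp
qed

text \<open>Ensures that the natural subtraction \<open>n * m - sum_list ys\<close> in the count
  below is never truncated.\<close>

lemma sum_list_le_length_mult:
  fixes ys :: "nat list"
  assumes "set ys \<subseteq> {..m}"
  shows "sum_list ys \<le> length ys * m"
  using assms by (induction ys) auto

lemma card_box_tuples_le:
  "2 * int (card {xs :: nat list. length xs = n + 1 \<and> sum_list xs \<le> n * m
              \<and> (\<forall>i<n. xs ! i < Suc m)})
     = int n * int (Suc m) ^ (n + 1) - (int n - 2) * int (Suc m) ^ n"
  (is "2 * int (card ?A) = _")
proof -
  let ?L = "{ys. length ys = n \<and> set ys \<subseteq> {..<Suc m}}"
  have fin: "finite ?L"
    using finite_lists_length_eq[of "{..<Suc m}" n] by (simp add: conj_commute)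
  have le: "sum_list ys \<le> n * m" if "ys \<in> ?L" for ys
    using sum_list_le_length_mult[of ys m] that by (auto simp: lessThan_Suc_atMost)
  \<comment> \<open>Splitting off the last entry fibres the tuples over the box, with an interval as
    fibre.\<close>
  have "bij_betw (\<lambda>(ys, k). ys @ [k]) (SIGMA ys:?L. {..n * m - sum_list ys}) ?A"
  proof (rule bij_betw_byWitness[where f' = "\<lambda>xs. (butlast xs, last xs)"])
    show "(\<lambda>(ys, k). ys @ [k]) ` (SIGMA ys:?L. {..n * m - sum_list ys}) \<subseteq> ?A"
      using le by (fastforce simp: nth_append set_conv_nth)
    show "(\<lambda>xs. (butlast xs, last xs)) ` ?A \<subseteq> (SIGMA ys:?L. {..n * m - sum_list ys})"
    proof (rule image_subsetI)
      fix xs assume xs: "xs \<in> ?A"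
      then have "xs \<noteq> []" by auto
      then obtain ys k where "xs = ys @ [k]" by (metis append_butlast_last_id)
      with xs show "(butlast xs, last xs) \<in> (SIGMA ys:?L. {..n * m - sum_list ys})"
        by (auto simp: nth_append in_set_conv_nth)
    qed
  qed (auto intro!: append_butlast_last_id)
  then have "card ?A = (\<Sum>ys\<in>?L. n * m - sum_list ys + 1)"
    using fin by (simp add: card_SigmaI flip: bij_betw_same_card)
  then have "int (card ?A) = (\<Sum>ys\<in>?L. int n * int m + 1 - int (sum_list ys))"
    using le by (simp add: of_nat_diff algebra_simps)
  also have "\<dots> = (int n * int m + 1) * int (Suc m) ^ n - (\<Sum>ys\<in>?L. int (sum_list ys))"
    by (simp only: sum_subtractf sum_constant card_box_lists of_nat_power mult_ac)
  \<comment> \<open>Doubling gives \<open>(n * m + 2) * Suc m ^ n\<close>, and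
    \<open>n * m + 2 = n * Suc m - (n - 2)\<close>.\<close>
  finally show ?thesis
    using sum_sum_list_box[of n m] by (simp add: algebra_simps)
qed

theorem corollary3p4:
  fixes n q :: nat
  assumes "n \<ge> 1"
  shows "real (card {xs :: nat list. length xs = n + 1
              \<and> int (sum_list xs) \<le> int n * (int q - 1)
              \<and> (\<forall>i<n. xs ! i < q)})
           = (\<Sum>i=1..n. (-1) ^ (n - i) * real (n choose i) * real ((i * q + 1) choose (n + 1)))
       \<and> (\<Sum>i=1..n. (-1) ^ (n - i) * real (n choose i) * real ((i * q + 1) choose (n + 1)))
           = (real n * real q ^ (n + 1) - (real n - 2) * real q ^ n) / 2"
    (is "real (card ?A) = ?S \<and> ?S = ?R")
proof -
  \<comment> \<open>The added term at \<open>i = 0\<close> contains \<open>1 choose (n + 1)\<close>,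
    which is 0 since \<open>n\<close> is positive.\<close>
  have "?S = (\<Sum>i=0..n. (-1) ^ (n - i) * real (n choose i) * real ((i * q + 1) choose (n + 1)))"
    using assms by (simp add: sum.atLeast_Suc_atMost[of 0])
  then have S: "?S = ?R"
    using alternating_sum_choose_mult by simp
  have "real (card ?A) = ?R"
  proof (cases q)
    case 0
    \<comment> \<open>Here the bound on the sum is \<open>- n\<close>, which is negative, and
      \<open>q ^ n = 0\<close> makes the right side vanish.\<close>
    have "?A = {}" using 0 assms by auto
    then show ?thesis using 0 assms by simp
  next
    case (Suc m)
    have "?A = {xs. length xs = n + 1 \<and> sum_list xs \<le> n * m \<and> (\<forall>i<n. xs ! i < Suc m)}"
      unfolding Suc by (simp flip: of_nat_mult)
    then have "2 * int (card ?A) = int n * int q ^ (n + 1) - (int n - 2) * int q ^ n"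
      using card_box_tuples_le[of n m] Suc by simp
    then have "real_of_int (2 * int (card ?A))
        = real_of_int (int n * int q ^ (n + 1) - (int n - 2) * int q ^ n)"
      by (rule arg_cong)
    then show ?thesis by simp
  qed
  with S show ?thesis by simp
qed

end
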